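(* Let $\beta_j>\lambda_j-\lambda_1$ for all $j\ge1$ and let $\{\mathfrak{u}_{\theta j}\}_{j\ge1}\subset H_0^1(\Omega)\setminus\{0\}$. Assume that for all $k\ge1$, $$L_k(\mathfrak{u}_{\theta k})-\lambda_k\le\Delta_k+8\beta_k\sum_{j=1}^{k-1}\sqrt{\frac{L_j(\mathfrak{u}_{\theta j})-\lambda_j}{\min\{\beta_j+\lambda_1-\lambda_j,\ \lambda_{j'}-\lambda_j\}}},$$ where $\Delta_k$ are real numbers. Let $\tau_k=\max_{1\le j\le k}\Delta_j/\beta_j$, $\rho_0=0$ and $\rho_k=\max_{1\le j\le k}4\sqrt{\beta_j/\min\{\beta_j+\lambda_1-\lambda_j,\lambda_{j'}-\lambda_j\}}$. Then for all $k\ge1$, $$L_k(\mathfrak{u}_{\theta k})-\lambda_k\le\beta_k\Big((k-1)\rho_{k-1}+\sqrt{\tau_k}\Big)^2.$$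
   Context: $\Omega=(0,1)^d$; $V:\Omega\to\mathbb{R}$ measurable with $0<V_{\min}\le V\le V_{\max}$; $\mathcal{H}=-\Delta+V$ with homogeneous Dirichlet boundary condition has eigenvalues $0<\lambda_1\le\lambda_2\le\cdots\uparrow\infty$ (with multiplicity) and $\lambda_{j'}$ is the first eigenvalue strictly greater than $\lambda_j$. $\{\psi_j\}$ are $L^2(\Omega)$-orthonormal eigenfunctions with $\mathcal{H}\psi_j=\lambda_j\psi_j$. For nonzero $u\in H_0^1(\Omega)$, $$L_j(u)=\frac{\int_\Omega(|\nabla u|^2+V|u|^2)dx+\beta_j\sum_{i=1}^{j-1}\langle u,\psi_i\rangle_{L^2(\Omega)}^2}{\|u\|_{L^2(\Omega)}^2},$$ so that $L_j(u)\ge\lambda_j$. *)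

theory Defs
  imports "HOL-Analysis.Analysis"
begin

section \<open>Function spaces on the unit cube\<close>

text \<open>Functions on the cube are represented by functions on the whole space; only their values on
  the cube matter. They are not identified modulo null sets, so ``nonzero'' and linear
  independence are always stated almost everywhere. The dimension $d$ is \<open>CARD('n)\<close>.\<close>

definition unit_cube :: "(real^'n) set" where
  "unit_cube = {x. \<forall>i. 0 < x $ i \<and> x $ i < 1}"

abbreviation cube_measure :: "(real^'n) measure" where
  "cube_measure \<equiv> lebesgue_on unit_cube"

definition L2 :: "(real^'n \<Rightarrow> 'b::euclidean_space) set" where
  "L2 = {f \<in> borel_measurable cube_measure. integrable cube_measure (\<lambda>x. (norm (f x))\<^sup>2)}"

definition l2_inner :: "(real^'n \<Rightarrow> real) \<Rightarrow> (real^'n \<Rightarrow> real) \<Rightarrow> real" where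
  "l2_inner f g = (LINT x|cube_measure. f x * g x)"

definition partial_deriv :: "'n \<Rightarrow> (real^'n \<Rightarrow> real) \<Rightarrow> real^'n \<Rightarrow> real" where
  "partial_deriv i f x = frechet_derivative f (at x) (axis i 1)"

definition gradient :: "(real^'n \<Rightarrow> real) \<Rightarrow> real^'n \<Rightarrow> real^'n" where
  "gradient f x = (\<chi> i. partial_deriv i f x)"

definition laplacian :: "(real^'n \<Rightarrow> real) \<Rightarrow> real^'n \<Rightarrow> real" where
  "laplacian f x = (\<Sum>i\<in>UNIV. partial_deriv i (partial_deriv i f) x)"

text \<open>All iterated partial derivatives are required to be totally differentiable, hence
  continuous, so this is $C^\infty$.\<close>

definition smooth :: "(real^'n \<Rightarrow> real) \<Rightarrow> bool" where
  "smooth f \<longleftrightarrow> (\<forall>is x. fold partial_deriv is f differentiable (at x))"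

definition test_functions :: "(real^'n \<Rightarrow> real) set" where
  "test_functions = {\<phi>. smooth \<phi> \<and> compact (closure {x. \<phi> x \<noteq> 0}) \<and>
     closure {x. \<phi> x \<noteq> 0} \<subseteq> unit_cube}"

definition is_weak_gradient :: "(real^'n \<Rightarrow> real) \<Rightarrow> (real^'n \<Rightarrow> real^'n) \<Rightarrow> bool" where
  "is_weak_gradient u G \<longleftrightarrow> G \<in> L2 \<and>
     (\<forall>\<phi>\<in>test_functions. \<forall>i.
        (LINT x|cube_measure. u x * partial_deriv i \<phi> x) =
        - (LINT x|cube_measure. G x $ i * \<phi> x))"

text \<open>Weak gradients are unique up to null sets, so integrals of the chosen one do not depend on
  the choice.\<close>

definition weak_gradient :: "(real^'n \<Rightarrow> real) \<Rightarrow> real^'n \<Rightarrow> real^'n" where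
  "weak_gradient u = (SOME G. is_weak_gradient u G)"

text \<open>$H^1_0$ is the closure of $C_c^\infty$ in the $H^1$ norm.\<close>

definition H10 :: "(real^'n \<Rightarrow> real) set" where
  "H10 = {u \<in> L2. \<exists>G. is_weak_gradient u G \<and>
     (\<exists>\<phi>. (\<forall>n::nat. \<phi> n \<in> test_functions) \<and>
       (\<lambda>n. LINT x|cube_measure. (\<phi> n x - u x)\<^sup>2) \<longlonglongrightarrow> 0 \<and>
       (\<lambda>n. LINT x|cube_measure. (norm (gradient (\<phi> n) x - G x))\<^sup>2) \<longlonglongrightarrow> 0)}"

definition is_weak_laplacian :: "(real^'n \<Rightarrow> real) \<Rightarrow> (real^'n \<Rightarrow> real) \<Rightarrow> bool" where
  "is_weak_laplacian u g \<longleftrightarrow> g \<in> L2 \<and>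
     (\<forall>\<phi>\<in>test_functions.
        (LINT x|cube_measure. u x * laplacian \<phi> x) = (LINT x|cube_measure. g x * \<phi> x))"


section \<open>The Dirichlet Schroedinger operator and its spectrum\<close>

text \<open>\<open>dirichlet_schroedinger V u f\<close> says that \<open>u\<close> lies in the operator domain
  $\{u \in H^1_0 : \Delta u \in L^2\}$ and that $-\Delta u + V u = f$. The domain imposes the
  homogeneous Dirichlet condition.\<close>

definition dirichlet_schroedinger ::
    "(real^'n \<Rightarrow> real) \<Rightarrow> (real^'n \<Rightarrow> real) \<Rightarrow> (real^'n \<Rightarrow> real) \<Rightarrow> bool" where
  "dirichlet_schroedinger V u f \<longleftrightarrow> u \<in> H10 \<and>
     (\<exists>g. is_weak_laplacian u g \<and> (AE x in cube_measure. - g x + V x * u x = f x))"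

definition eigenspace :: "(real^'n \<Rightarrow> real) \<Rightarrow> real \<Rightarrow> (real^'n \<Rightarrow> real) set" where
  "eigenspace V \<mu> = {u. dirichlet_schroedinger V u (\<lambda>x. \<mu> * u x)}"

text \<open>\<open>has_ae_dim E m\<close>: modulo equality almost everywhere, \<open>E\<close> has a basis of \<open>m\<close> elements.\<close>

definition has_ae_dim :: "(real^'n \<Rightarrow> real) set \<Rightarrow> nat \<Rightarrow> bool" where
  "has_ae_dim E m \<longleftrightarrow> (\<exists>b::nat \<Rightarrow> real^'n \<Rightarrow> real. (\<forall>i<m. b i \<in> E) \<and>
     (\<forall>c. (AE x in cube_measure. (\<Sum>i<m. c i * b i x) = 0) \<longrightarrow> (\<forall>i<m. c i = 0)) \<and>
     (\<forall>u\<in>E. \<exists>c. AE x in cube_measure. u x = (\<Sum>i<m. c i * b i x)))"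

text \<open>Sequences are indexed from 1; their value at 0 is irrelevant. The last conjunct says that
  \<open>lam\<close> lists every eigenvalue as often as its multiplicity and lists nothing else: a number
  that is not an eigenvalue has an eigenspace of dimension 0.\<close>

definition dirichlet_eigenvalues :: "(real^'n \<Rightarrow> real) \<Rightarrow> (nat \<Rightarrow> real) \<Rightarrow> bool" where
  "dirichlet_eigenvalues V lam \<longleftrightarrow>
     0 < lam 1 \<and> mono_on {1..} lam \<and> filterlim lam at_top sequentially \<and>
     (\<forall>\<mu>. has_ae_dim (eigenspace V \<mu>) (card {j. 1 \<le> j \<and> lam j = \<mu>}))"

definition l2_orthonormal :: "(nat \<Rightarrow> real^'n \<Rightarrow> real) \<Rightarrow> bool" where
  "l2_orthonormal \<psi> \<longleftrightarrow> (\<forall>i\<ge>1. \<forall>j\<ge>1. l2_inner (\<psi> i) (\<psi> j) = (if i = j then 1 else 0))"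

text \<open>The index written $j'$: the first one whose eigenvalue strictly exceeds the $j$-th.\<close>

definition next_index :: "(nat \<Rightarrow> real) \<Rightarrow> nat \<Rightarrow> nat" where
  "next_index lam j = (LEAST i. 1 \<le> i \<and> lam j < lam i)"

definition penalized_rayleigh :: "(real^'n \<Rightarrow> real) \<Rightarrow> (nat \<Rightarrow> real^'n \<Rightarrow> real) \<Rightarrow>
    (nat \<Rightarrow> real) \<Rightarrow> nat \<Rightarrow> (real^'n \<Rightarrow> real) \<Rightarrow> real" where
  "penalized_rayleigh V \<psi> \<beta> j u =
     ((LINT x|cube_measure. (norm (weak_gradient u x))\<^sup>2 + V x * \<bar>u x\<bar>\<^sup>2) +
       \<beta> j * (\<Sum>i\<in>{1..<j}. (l2_inner u (\<psi> i))\<^sup>2)) /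
     (LINT x|cube_measure. (u x)\<^sup>2)"

end

theory Submission
  imports Defs
begin

text \<open>
  The proposition is a fact about real sequences. The operator enters through its eigenvalues:
  as they are ordered and unbounded, the coefficients \<open>\<beta> j\<close> and the gaps are positive.
  Write \<open>a k\<close> for the excess \<open>L k (u k) - lam k\<close>.

  Divided by \<open>\<beta> k\<close>, the hypothesis bounds \<open>a k / \<beta> k\<close> by
  \<open>\<Delta> k / \<beta> k\<close> plus a sum over \<open>j < k\<close>. If the claim holds at \<open>j\<close>,
  the \<open>j\<close>-th summand is at most \<open>2 * R * ((j - 1) * R + T)\<close>, where
  \<open>R = \<rho> (k - 1)\<close> and \<open>T = sqrt (\<tau> k)\<close>, because \<open>\<rho>\<close> and
  \<open>\<tau>\<close> increase. This is at most the increment of the square \<open>(x * R + T)\<^sup>2\<close>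
  from \<open>x = j - 1\<close> to \<open>x = j\<close>, so the sum telescopes to
  \<open>((k - 1) * R + T)\<^sup>2 - T\<^sup>2\<close>, and the remaining \<open>T\<^sup>2\<close> dominates
  \<open>\<Delta> k / \<beta> k\<close>. This is \<open>recursive_excess_bound\<close>.

  The telescoping argument presupposes \<open>T\<^sup>2 = \<tau> k\<close>, that is,
  \<open>0 \<le> \<tau> k\<close>. If \<open>\<tau> k < 0\<close>, then all of
  \<open>\<Delta> 1, \<dots>, \<Delta> k\<close> are negative, and since the real square root is extended to
  negative arguments as an odd monotone function, the recursion forces \<open>a k\<close> to be
  negative as well (\<open>recursive_excess_neg\<close>), whereas the claimed bound is nonnegative. The
  induction therefore runs with the nonnegative \<open>sqrt (max 0 (\<tau> k))\<close> in place of
  \<open>sqrt (\<tau> k)\<close>.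
\<close>

text \<open>Each summand is bounded by the increment of a square; the discarded part of the
  increment is \<open>r\<^sup>2\<close>.\<close>

lemma sum_le_telescoping_squares:
  fixes r t :: real
  assumes "1 \<le> k"
  shows "(\<Sum>j\<in>{1..<k}. 2 * r * (real (j - 1) * r + t)) \<le> (real (k - 1) * r + t)\<^sup>2 - t\<^sup>2"
  using assms
proof (induction k rule: dec_induct)
  case base
  show ?case by simp
next
  case (step n)
  have n: "real n = real (n - 1) + 1"
    using step.hyps by simp
  have "2 * r * (real (n - 1) * r + t) \<le> (real n * r + t)\<^sup>2 - (real (n - 1) * r + t)\<^sup>2"
    unfolding n by (simp add: power2_eq_square algebra_simps)
  with step show ?case
    by simp
qed

text \<open>The sequences \<open>r\<close> and \<open>t\<close> may be any increasing majorants. Monotonicity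
  is what allows the two values at \<open>k - 1\<close> and \<open>k\<close> to replace all earlier ones in the
  sum, so that the summands become increments of a single square.\<close>

lemma recursive_excess_bound:
  fixes a \<beta> g \<Delta> r t :: "nat \<Rightarrow> real"
  assumes beta_pos: "\<And>j. 1 \<le> j \<Longrightarrow> 0 < \<beta> j"
    and gap_pos: "\<And>j. 1 \<le> j \<Longrightarrow> 0 < g j"
    and rec: "\<And>k. 1 \<le> k \<Longrightarrow>
      a k \<le> \<Delta> k + 8 * \<beta> k * (\<Sum>j\<in>{1..<k}. sqrt (a j / g j))"
    and r_ge: "\<And>j. 1 \<le> j \<Longrightarrow> 4 * sqrt (\<beta> j / g j) \<le> r j"
    and r_mono: "mono r" and r_nonneg: "\<And>j. 0 \<le> r j"
    and t_ge: "\<And>j. 1 \<le> j \<Longrightarrow> \<Delta> j / \<beta> j \<le> (t j)\<^sup>2"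
    and t_mono: "mono_on {1..} t" and t_nonneg: "\<And>j. 0 \<le> t j"
    and "1 \<le> k"
  shows "a k \<le> \<beta> k * (real (k - 1) * r (k - 1) + t k)\<^sup>2"
  using \<open>1 \<le> k\<close>
proof (induction k rule: less_induct)
  case (less k)
  define R where "R = r (k - 1)"
  define T where "T = t k"
  have summand: "8 * sqrt (a j / g j) \<le> 2 * R * (real (j - 1) * R + T)" if j: "j \<in> {1..<k}" for j
  proof -
    let ?b = "real (j - 1) * r (j - 1) + t j"
    have b_nonneg: "0 \<le> ?b"
      by (simp add: r_nonneg t_nonneg)
    have "a j / g j \<le> (\<beta> j / g j) * ?b\<^sup>2"
      using less.IH[of j] gap_pos[of j] j by (simp add: field_simps)
    then have "sqrt (a j / g j) \<le> sqrt ((\<beta> j / g j) * ?b\<^sup>2)"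
      by (rule real_sqrt_le_mono)
    also have "\<dots> = sqrt (\<beta> j / g j) * ?b"
      unfolding real_sqrt_mult using b_nonneg by simp
    finally have "8 * sqrt (a j / g j) \<le> 2 * (4 * sqrt (\<beta> j / g j)) * ?b"
      by simp
    also have "\<dots> \<le> 2 * R * (real (j - 1) * R + T)"
    proof (rule mult_mono)
      have "r j \<le> R"
        unfolding R_def using j by (intro monoD[OF r_mono]) auto
      then show "2 * (4 * sqrt (\<beta> j / g j)) \<le> 2 * R"
        using r_ge[of j] j by simp
      have "r (j - 1) \<le> R"
        unfolding R_def using j by (intro monoD[OF r_mono]) auto
      moreover have "t j \<le> T"
        unfolding T_def using j by (intro mono_onD[OF t_mono]) auto
      ultimately show "?b \<le> real (j - 1) * R + T"
        by (intro add_mono mult_left_mono) auto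
      show "0 \<le> 2 * R"
        by (simp add: R_def r_nonneg)
    qed (rule b_nonneg)
    finally show ?thesis .
  qed
  have bpos: "0 < \<beta> k"
    using beta_pos less.prems .
  have "a k \<le> \<Delta> k + 8 * \<beta> k * (\<Sum>j\<in>{1..<k}. sqrt (a j / g j))"
    using rec less.prems .
  also have "\<dots> = \<beta> k * (\<Delta> k / \<beta> k + (\<Sum>j\<in>{1..<k}. 8 * sqrt (a j / g j)))"
    using bpos by (simp add: sum_distrib_left[symmetric] field_simps)
  also have "\<dots> \<le> \<beta> k * (T\<^sup>2 + (\<Sum>j\<in>{1..<k}. 2 * R * (real (j - 1) * R + T)))"
    using bpos t_ge[OF less.prems] summand unfolding T_def[symmetric]
    by (intro mult_left_mono add_mono sum_mono) auto
  also have "\<dots> \<le> \<beta> k * (real (k - 1) * R + T)\<^sup>2"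
    using bpos sum_le_telescoping_squares[OF less.prems, of R T]
    by (intro mult_left_mono) auto
  finally show ?case
    by (simp add: R_def T_def)
qed

text \<open>Here \<open>sqrt (a j / g j)\<close> is negative whenever \<open>a j\<close> is, so negative data
  propagate through the recursion.\<close>

lemma recursive_excess_neg:
  fixes a \<beta> g \<Delta> :: "nat \<Rightarrow> real"
  assumes beta_pos: "\<And>j. 1 \<le> j \<Longrightarrow> 0 < \<beta> j"
    and gap_pos: "\<And>j. 1 \<le> j \<Longrightarrow> 0 < g j"
    and rec: "\<And>k. 1 \<le> k \<Longrightarrow>
      a k \<le> \<Delta> k + 8 * \<beta> k * (\<Sum>j\<in>{1..<k}. sqrt (a j / g j))"
    and neg: "\<And>j. 1 \<le> j \<Longrightarrow> j \<le> k \<Longrightarrow> \<Delta> j < 0"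
    and "1 \<le> k"
  shows "a k < 0"
  using \<open>1 \<le> k\<close> neg
proof (induction k rule: less_induct)
  case (less k)
  have "sqrt (a j / g j) \<le> 0" if "j \<in> {1..<k}" for j
  proof -
    have "a j < 0"
      using that less.prems by (intro less.IH) auto
    then show ?thesis
      using gap_pos[of j] that by (simp add: divide_le_0_iff)
  qed
  then have "8 * \<beta> k * (\<Sum>j\<in>{1..<k}. sqrt (a j / g j)) \<le> 0"
    using beta_pos[OF less.prems(1)] by (intro mult_nonneg_nonpos sum_nonpos) auto
  moreover have "\<Delta> k < 0"
    using less.prems by simp
  ultimately show ?case
    using rec[OF less.prems(1)] by linarith
qed

lemma lam_less_next_index:
  assumes "filterlim lam at_top sequentially"
  shows "lam j < lam (next_index lam j)"
proof -
  have "\<forall>\<^sub>F i in sequentially. lam j < lam i"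
    using assms by (simp add: filterlim_at_top_dense)
  then have "\<forall>\<^sub>F i in sequentially. 1 \<le> i \<and> lam j < lam i"
    by (intro eventually_conj eventually_ge_at_top)
  then have "\<exists>i. 1 \<le> i \<and> lam j < lam i"
    by (rule eventually_happens'[OF sequentially_bot])
  then show ?thesis
    unfolding next_index_def by (rule LeastI2_ex) simp
qed

lemma mono_on_running_Max:
  fixes f :: "nat \<Rightarrow> 'a::linorder"
  shows "mono_on {1..} (\<lambda>k. MAX j\<in>{1..k}. f j)"
  by (intro mono_onI Max_mono image_mono) auto

theorem proposition15:
  fixes V :: "real^'n \<Rightarrow> real" and Vmin Vmax :: real
    and lam \<beta> \<Delta> \<tau> \<rho> :: "nat \<Rightarrow> real"
    and \<psi> u :: "nat \<Rightarrow> real^'n \<Rightarrow> real"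
  defines "L \<equiv> penalized_rayleigh V \<psi> \<beta>"
  defines "gap \<equiv> \<lambda>j. min (\<beta> j + lam 1 - lam j) (lam (next_index lam j) - lam j)"
  assumes V_meas: "V \<in> borel_measurable (lebesgue_on unit_cube)"
    and V_bounds: "0 < Vmin" "\<And>x. x \<in> unit_cube \<Longrightarrow> Vmin \<le> V x \<and> V x \<le> Vmax"
    and eigenvalues: "dirichlet_eigenvalues V lam"
    and eigenfunctions: "\<And>j. 1 \<le> j \<Longrightarrow> \<psi> j \<in> eigenspace V (lam j)"
    and orthonormal: "l2_orthonormal \<psi>"
    and beta: "\<And>j. 1 \<le> j \<Longrightarrow> \<beta> j > lam j - lam 1"
    and u_H10: "\<And>j. 1 \<le> j \<Longrightarrow> u j \<in> H10"
    and u_nonzero: "\<And>j. 1 \<le> j \<Longrightarrow> \<not> (AE x in lebesgue_on unit_cube. u j x = 0)"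
    and recursive_bound: "\<And>k. 1 \<le> k \<Longrightarrow>
      L k (u k) - lam k \<le> \<Delta> k + 8 * \<beta> k * (\<Sum>j\<in>{1..<k}. sqrt ((L j (u j) - lam j) / gap j))"
    and tau: "\<And>k. 1 \<le> k \<Longrightarrow> \<tau> k = (MAX j\<in>{1..k}. \<Delta> j / \<beta> j)"
    and rho_0: "\<rho> 0 = 0"
    and rho: "\<And>k. 1 \<le> k \<Longrightarrow> \<rho> k = (MAX j\<in>{1..k}. 4 * sqrt (\<beta> j / gap j))"
  shows "\<forall>k\<ge>1. L k (u k) - lam k \<le> \<beta> k * (real (k - 1) * \<rho> (k - 1) + sqrt (\<tau> k))\<^sup>2"
proof (intro allI impI)
  fix k :: nat
  assume k: "1 \<le> k"
  define a where "a = (\<lambda>j. L j (u j) - lam j)"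
  define t where "t = (\<lambda>j. sqrt (max 0 (\<tau> j)))"
  have lam_ge: "lam 1 \<le> lam j" if "1 \<le> j" for j
    using eigenvalues that unfolding dirichlet_eigenvalues_def by (auto elim!: mono_onD)
  have beta_pos: "0 < \<beta> j" if "1 \<le> j" for j
    using beta[OF that] lam_ge[OF that] by simp
  have lam_lim: "filterlim lam at_top sequentially"
    using eigenvalues unfolding dirichlet_eigenvalues_def by blast
  have gap_pos: "0 < gap j" if "1 \<le> j" for j
    using beta[OF that] lam_less_next_index[OF lam_lim, of j] by (simp add: gap_def)
  have rec: "a i \<le> \<Delta> i + 8 * \<beta> i * (\<Sum>j\<in>{1..<i}. sqrt (a j / gap j))" if "1 \<le> i" for i
    using recursive_bound[OF that] by (simp add: a_def)
  have rho_ge: "4 * sqrt (\<beta> j / gap j) \<le> \<rho> j" if "1 \<le> j" for j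
    using that by (simp add: rho)
  have rho_nonneg: "0 \<le> \<rho> j" for j
  proof (cases "j = 0")
    case False
    then have "0 \<le> 4 * sqrt (\<beta> j / gap j)"
      using beta_pos[of j] gap_pos[of j] by simp
    then show ?thesis
      using rho_ge[of j] False by linarith
  qed (simp add: rho_0)
  have rho_mono: "mono \<rho>"
  proof (rule monoI)
    fix i j :: nat
    assume ij: "i \<le> j"
    show "\<rho> i \<le> \<rho> j"
    proof (cases "i = 0")
      case False
      then show ?thesis
        using ij mono_onD[OF mono_on_running_Max, of i j "\<lambda>j. 4 * sqrt (\<beta> j / gap j)"]
        by (simp add: rho)
    qed (simp add: rho_0 rho_nonneg)
  qed
  have tau_ge: "\<Delta> i / \<beta> i \<le> \<tau> j" if "1 \<le> i" "i \<le> j" for i j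
    using that by (simp add: tau)
  have tau_mono: "\<tau> i \<le> \<tau> j" if "1 \<le> i" "i \<le> j" for i j
    using that mono_onD[OF mono_on_running_Max, of i j "\<lambda>j. \<Delta> j / \<beta> j"]
    by (simp add: tau)
  have t_mono: "mono_on {1..} t"
    unfolding t_def by (intro mono_onI real_sqrt_le_mono max.mono order_refl tau_mono) auto
  have t_ge: "\<Delta> j / \<beta> j \<le> (t j)\<^sup>2" if "1 \<le> j" for j
    using tau_ge[of j j] that by (simp add: t_def)
  have t_nonneg: "0 \<le> t j" for j
    by (simp add: t_def)
  have "a k \<le> \<beta> k * (real (k - 1) * \<rho> (k - 1) + sqrt (\<tau> k))\<^sup>2"
  proof (cases "0 \<le> \<tau> k")
    case True
    then have "t k = sqrt (\<tau> k)"
      by (simp add: t_def)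
    with recursive_excess_bound[of \<beta> gap a \<Delta> \<rho> t k, OF beta_pos gap_pos rec rho_ge rho_mono
        rho_nonneg t_ge t_mono t_nonneg k]
    show ?thesis
      by simp
  next
    case False
    have Delta_neg: "\<Delta> j < 0" if "1 \<le> j" "j \<le> k" for j
    proof -
      have "\<Delta> j / \<beta> j < 0"
        using tau_ge[OF that] False by linarith
      then show ?thesis
        using beta_pos[OF that(1)] by (simp add: divide_less_0_iff)
    qed
    have "a k < 0"
      using beta_pos gap_pos rec Delta_neg k by (rule recursive_excess_neg)
    also have "0 \<le> \<beta> k * (real (k - 1) * \<rho> (k - 1) + sqrt (\<tau> k))\<^sup>2"
      using beta_pos[OF k] by simp
    finally show ?thesis
      by simp
  qed
  then show "L k (u k) - lam k \<le> \<beta> k * (real (k - 1) * \<rho> (k - 1) + sqrt (\<tau> k))\<^sup>2"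
    by (simp add: a_def)
qed

end
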